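(* Let $K$ be a field of characteristic zero and let $\mathcal{A}$ be a unital $K$-algebra such that every $K$-subalgebra of $\mathcal{A}$ generated by finitely many elements of $\mathcal{A}$ is finite dimensional over $K$. Let $\delta$ be either a locally finite $K$-derivation of $\mathcal{A}$, or a locally finite $K$-$\mathcal{E}$-derivation of $\mathcal{A}$ of the form $\delta=\mathrm{I}-\phi$ for some $K$-algebra endomorphism $\phi$ of $\mathcal{A}$ such that the induced map $\bar\phi$ on $\mathcal{A}/\operatorname{Ker}_{\ge1}\phi$ is surjective (e.g., when $\phi$ itself is surjective). Then the image $\operatorname{Im}\delta=\delta(\mathcal{A})$ is a Mathieu subspace of $\mathcal{A}$.
   Context: Algebras are associative, not necessarily commutative. $\mathrm{I}$ denotes the identity map of $\mathcal{A}$. $K$-algebra endomorphisms are $K$-linear multiplicative maps (not required to preserve the identity element). A $K$-linear endomorphism $\eta$ of $\mathcal{A}$ is locally finite if for each $a\in\mathcal{A}$ the $K$-subspace spanned by $\eta^i(a)$ $(i\ge 0)$ is finite dimensional. A $K$-derivation of $\mathcal{A}$ is a $K$-linear map $D:\mathcal{A}\to\mathcal{A}$ with $D(ab)=D(a)b+aD(b)$ for all $a,b$. A $K$-$\mathcal{E}$-derivation is a $K$-linear map $\delta$ with $\delta(ab)=\delta(a)b+a\delta(b)-\delta(a)\delta(b)$ for all $a,b$; equivalently, $\delta=\mathrm{I}-\phi$ for some $K$-algebra endomorphism $\phi$. $\operatorname{Ker}_{\ge1}\phi:=\sum_{i=1}^\infty\operatorname{Ker}\phi^i$, a two-sided ideal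 of $\mathcal{A}$; $\bar\phi$ is the endomorphism of $\mathcal{A}/\operatorname{Ker}_{\ge1}\phi$ induced by $\phi$. A $K$-subspace $V$ of $\mathcal{A}$ is a (two-sided) Mathieu subspace of $\mathcal{A}$ if for all $a,b,c\in\mathcal{A}$ with $a^m\in V$ for all $m\ge1$, one has $ba^mc\in V$ for all sufficiently large $m$. *)

theory Defs
  imports Main "HOL.Vector_Spaces" "HOL.Hull" "HOL-Library.Set_Algebras"
begin

text \<open>
  The sort \<open>{ring, monoid_mult}\<close> is used instead of \<open>ring_1\<close>, which would exclude the zero algebra.
\<close>

locale unital_algebra = vector_space scale
  for scale :: "'k::field \<Rightarrow> 'a::{ring, monoid_mult} \<Rightarrow> 'a" (infixr "*s" 75) +
  assumes scale_mult_left: "(r *s x) * y = r *s (x * y)"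
    and scale_mult_right: "x * (r *s y) = r *s (x * y)"
begin

definition fin_dim :: "'a set \<Rightarrow> bool" where
  "fin_dim V \<longleftrightarrow> (\<exists>B. finite B \<and> independent B \<and> span B = V)"

text \<open>
  Like algebra endomorphisms below, subalgebras need not respect the identity element. For the
  finite-dimensionality of finitely generated subalgebras this makes no difference, because
  \<open>1\<close> may be added to the generators.
\<close>

definition subalgebra :: "'a set \<Rightarrow> bool" where
  "subalgebra B \<longleftrightarrow> subspace B \<and> (\<forall>x\<in>B. \<forall>y\<in>B. x * y \<in> B)"

definition generated_subalgebra :: "'a set \<Rightarrow> 'a set" where
  "generated_subalgebra S = subalgebra hull S"

definition locally_finite :: "('a \<Rightarrow> 'a) \<Rightarrow> bool" where
  "locally_finite \<eta> \<longleftrightarrow>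
     Vector_Spaces.linear scale scale \<eta> \<and> (\<forall>a. fin_dim (span (range (\<lambda>i. (\<eta> ^^ i) a))))"

definition derivation :: "('a \<Rightarrow> 'a) \<Rightarrow> bool" where
  "derivation D \<longleftrightarrow>
     Vector_Spaces.linear scale scale D \<and> (\<forall>a b. D (a * b) = D a * b + a * D b)"

definition E_derivation :: "('a \<Rightarrow> 'a) \<Rightarrow> bool" where
  "E_derivation \<delta> \<longleftrightarrow>
     Vector_Spaces.linear scale scale \<delta> \<and>
     (\<forall>a b. \<delta> (a * b) = \<delta> a * b + a * \<delta> b - \<delta> a * \<delta> b)"

definition algebra_endo :: "('a \<Rightarrow> 'a) \<Rightarrow> bool" where
  "algebra_endo \<phi> \<longleftrightarrow>
     Vector_Spaces.linear scale scale \<phi> \<and> (\<forall>a b. \<phi> (a * b) = \<phi> a * \<phi> b)"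

text \<open>The sum of a family of subspaces is the span of their union.\<close>

definition Ker_ge1 :: "('a \<Rightarrow> 'a) \<Rightarrow> 'a set" where
  "Ker_ge1 \<phi> = span (\<Union>i\<in>{1..}. {a. (\<phi> ^^ i) a = 0})"

definition quotient_space :: "'a set \<Rightarrow> 'a set set" where
  "quotient_space I = range (\<lambda>a. a +o I)"

text \<open>
  The union merges the cosets of the images of all representatives of \<open>C\<close>; these coincide when
  \<open>\<phi>\<close> is an algebra endomorphism and \<open>C\<close> is a coset, see \<open>induced_map_coset\<close>.
\<close>

definition induced_map :: "('a \<Rightarrow> 'a) \<Rightarrow> 'a set \<Rightarrow> 'a set" where
  "induced_map \<phi> C = (\<Union>a\<in>C. \<phi> a +o Ker_ge1 \<phi>)"

definition mathieu_subspace :: "'a set \<Rightarrow> bool" where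
  "mathieu_subspace V \<longleftrightarrow>
     subspace V \<and>
     (\<forall>a b c. (\<forall>m\<ge>1. a ^ m \<in> V) \<longrightarrow> (\<forall>\<^sub>F m in sequentially. b * a ^ m * c \<in> V))"

lemma E_derivation_iff: "E_derivation \<delta> \<longleftrightarrow> (\<exists>\<phi>. algebra_endo \<phi> \<and> \<delta> = (\<lambda>a. a - \<phi> a))"
proof
  assume E: "E_derivation \<delta>"
  have "algebra_endo (\<lambda>a. a - \<delta> a)"
    using E unfolding E_derivation_def algebra_endo_def linear_iff
    by (auto simp: algebra_simps)
  then show "\<exists>\<phi>. algebra_endo \<phi> \<and> \<delta> = (\<lambda>a. a - \<phi> a)"
    by (intro exI[of _ "\<lambda>a. a - \<delta> a"]) auto
next
  assume "\<exists>\<phi>. algebra_endo \<phi> \<and> \<delta> = (\<lambda>a. a - \<phi> a)"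
  then show "E_derivation \<delta>"
    unfolding E_derivation_def algebra_endo_def linear_iff
    by (auto simp: algebra_simps)
qed

lemma linear_funpow:
  assumes "Vector_Spaces.linear scale scale \<phi>"
  shows "Vector_Spaces.linear scale scale (\<phi> ^^ i)"
  using assms by (induction i) (auto simp: linear_iff vector_space_axioms)

lemma Ker_ge1_invariant:
  assumes "algebra_endo \<phi>" "x \<in> Ker_ge1 \<phi>"
  shows "\<phi> x \<in> Ker_ge1 \<phi>"
proof -
  have lin: "Vector_Spaces.linear scale scale \<phi>"
    using assms(1) by (simp add: algebra_endo_def)
  interpret linear scale scale \<phi> by (rule lin)
  show ?thesis
    using assms(2) unfolding Ker_ge1_def
  proof (induction rule: span_induct_alt)
    case base
    then show ?case by (simp add: zero span_zero)
  next
    case (step c x y)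
    then obtain i where i: "i \<ge> 1" "(\<phi> ^^ i) x = 0" by auto
    have "(\<phi> ^^ i) (\<phi> x) = \<phi> ((\<phi> ^^ i) x)" by (simp add: funpow_swap1)
    then have "(\<phi> ^^ i) (\<phi> x) = 0" using i by (simp add: zero)
    then have "\<phi> x \<in> (\<Union>i\<in>{1..}. {a. (\<phi> ^^ i) a = 0})" using i by blast
    then show ?case using step.IH by (simp add: add scale span_add span_scale span_base)
  qed
qed

lemma induced_map_coset:
  assumes "algebra_endo \<phi>"
  shows "induced_map \<phi> (a +o Ker_ge1 \<phi>) = \<phi> a +o Ker_ge1 \<phi>"
proof -
  have sub: "subspace (Ker_ge1 \<phi>)" by (simp add: Ker_ge1_def)
  have add: "\<phi> (x + y) = \<phi> x + \<phi> y" for x y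
    using assms by (simp add: algebra_endo_def linear_iff)
  have "0 \<in> Ker_ge1 \<phi>" using sub by (rule subspace_0)
  then show ?thesis
    using Ker_ge1_invariant[OF assms] subspace_add[OF sub]
    by (fastforce simp: induced_map_def elt_set_plus_def add add.assoc)
qed

end

end

theory Submission
  imports Defs
begin

text \<open>
  A subspace \<open>V\<close> of an algebra whose one-generated subalgebras are finite dimensional is a Mathieu
  subspace as soon as it contains the two-sided ideal generated by each idempotent in \<open>V\<close>. Indeed,
  if \<open>V\<close> contains all positive powers of \<open>a\<close>, then it contains the (non-unital) algebra generated by
  \<open>a\<close>, and that finite-dimensional algebra has an idempotent \<open>e\<close> with \<open>a ^ k * e = a ^ k\<close>, so
  from the exponent \<open>k\<close> on the powers of \<open>a\<close> lie in the ideal generated by \<open>e\<close>. This is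
  \<open>exists_idempotent_absorbing_power\<close> and \<open>mathieu_subspace_if_idempotents_absorbed\<close>.

  It remains to understand the idempotents \<open>e = \<delta> x\<close>. Local finiteness of \<open>\<delta>\<close> places \<open>x\<close> in a finitely
  generated, hence finite-dimensional, \<open>\<delta>\<close>-stable subalgebra \<open>G\<close>, where traces are available. Left
  multiplication by an idempotent is a projection, so its trace is the dimension of its image; in
  characteristic zero a vanishing trace forces \<open>e = 0\<close> (\<open>idempotent_eq_0_if_trace_0\<close>).

  For a derivation \<open>D\<close>, left multiplication by \<open>D x\<close> is the commutator of \<open>D\<close> with left
  multiplication by \<open>x\<close>, so its trace is zero and the only idempotent in the image is \<open>0\<close>.

  For \<open>\<delta> = I - \<phi>\<close>, some power \<open>\<phi>\<^sup>n\<close> maps \<open>G\<close> onto a subalgebra \<open>C\<close> on which \<open>\<phi>\<close> is bijective (Fitting).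
  On \<open>C\<close>, left multiplication by \<open>\<phi> z\<close> is conjugate by \<open>\<phi>\<close> to left multiplication by \<open>z\<close>, so left
  multiplication by \<open>z - \<phi> z\<close> has trace zero; applied to \<open>z = \<phi>\<^sup>n x\<close> this gives \<open>\<phi>\<^sup>n e = 0\<close>.
  Finally the kernel of \<open>\<phi>\<^sup>n\<close> is a two-sided ideal, and it lies in the image of \<open>I - \<phi>\<close> by a
  telescoping sum.
\<close>

context unital_algebra
begin

section \<open>Finite-dimensional subspaces and the Fitting decomposition\<close>

lemma fin_dim_span_finite:
  assumes "finite B"
  shows "fin_dim (span B)"
proof -
  obtain A where "A \<subseteq> B" "independent A" "B \<subseteq> span A"
    by (rule maximal_independent_subset)
  then have "finite A" "independent A" "span A = span B"
    using assms finite_subset by (auto simp: span_eq intro: span_base)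
  then show ?thesis
    unfolding fin_dim_def by blast
qed

lemma fin_dim_image:
  assumes "Vector_Spaces.linear scale scale f" "fin_dim V"
  shows "fin_dim (f ` V)"
proof -
  interpret f: linear scale scale f by fact
  obtain B where "finite B" "span B = V"
    using assms(2) fin_dim_def by blast
  then show ?thesis
    using fin_dim_span_finite[of "f ` B"] f.span_image[of B] by simp
qed

lemma span_eq_of_independent_of_card_le:
  assumes "finite B" "independent A" "A \<subseteq> span B" "card B \<le> card A"
  shows "span A = span B"
proof (rule ccontr)
  assume "span A \<noteq> span B"
  moreover have "span A \<subseteq> span B"
    using assms(3) by (simp add: span_minimal)
  ultimately obtain v where v: "v \<in> span B" "v \<notin> span A"
    by auto
  have "independent (insert v A)"
    using assms(2) v(2) by (simp add: independent_insertI)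
  then have "finite (insert v A) \<and> card (insert v A) \<le> card B"
    using assms(3) v(1) by (intro independent_span_bound[OF assms(1)]) simp_all
  moreover have "v \<notin> A"
    using v(2) span_base by blast
  ultimately show False
    using assms(4) by (auto simp: card_insert_if)
qed

text \<open>
  The dimensions of the images \<open>f\<^sup>n W\<close> cannot decrease forever. At an exponent where the dimension is
  least, \<open>f\<close> sends a basis of \<open>f\<^sup>n W\<close> to a spanning set of an image that is no smaller, hence
  injectively to a basis of it. Equality of the dimensions also turns the inclusion
  \<open>f (f\<^sup>n W) \<subseteq> f\<^sup>n W\<close> into an equality.
\<close>
lemma fitting_bijective_power:
  assumes lin: "Vector_Spaces.linear scale scale f"
    and fin: "fin_dim W" and inv: "f ` W \<subseteq> W"
  obtains n where "inj_on f ((f ^^ n) ` W)" "f ` ((f ^^ n) ` W) = (f ^^ n) ` W"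
proof -
  interpret f: linear scale scale f by (rule lin)
  interpret vector_space_pair scale scale ..
  obtain n where n: "\<And>m. dim ((f ^^ n) ` W) \<le> dim ((f ^^ m) ` W)"
    using ex_has_least_nat[of "\<lambda>_. True" _ "\<lambda>n. dim ((f ^^ n) ` W)"] by auto
  define C where "C = (f ^^ n) ` W"
  have fC: "f ` C = (f ^^ Suc n) ` W"
    by (simp add: C_def image_comp)
  have "f ` C = (f ^^ n) ` (f ` W)"
    by (simp add: fC image_comp funpow_Suc_right del: funpow.simps)
  then have fC_sub: "f ` C \<subseteq> C"
    using inv by (auto simp: C_def)
  have "fin_dim C"
    unfolding C_def by (rule fin_dim_image[OF linear_funpow[OF lin] fin])
  then obtain B where B: "finite B" "independent B" "span B = C"
    unfolding fin_dim_def by blast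
  have span_fB: "span (f ` B) = f ` C"
    using B(3) f.span_image by blast
  obtain A where A: "A \<subseteq> f ` B" "independent A" "f ` B \<subseteq> span A"
    by (rule maximal_independent_subset)
  have span_A: "span A = f ` C"
    using A span_fB by (metis span_eq span_superset subset_trans)
  have "card B = dim C"
    using B dim_span_eq_card_independent by metis
  also have "\<dots> \<le> dim (f ` C)"
    using n[of "Suc n"] by (simp only: C_def[symmetric] fC)
  also have "\<dots> = card A"
    using A(2) span_A dim_span_eq_card_independent by metis
  finally have card_A: "card B \<le> card A" .
  have "card A \<le> card (f ` B)" "card (f ` B) \<le> card B"
    using A(1) B(1) by (auto intro: card_mono card_image_le)
  with card_A have card_fB: "card (f ` B) = card B" "card A = card (f ` B)"
    by auto
  then have "A = f ` B"
    using A(1) B(1) by (simp add: card_subset_eq)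
  moreover have "inj_on f B"
    using card_fB(1) B(1) by (simp add: eq_card_imp_inj_on)
  ultimately have "inj_on f C"
    using A(2) B linear_inj_on_span_iff_independent_image[OF lin, of B]
      linear_inj_on_span_independent_image[OF lin, of B] by simp
  moreover have "f ` C = C"
    using span_eq_of_independent_of_card_le[OF B(1) A(2) _ card_A] fC_sub span_A B(3)
      span_superset[of A] by simp
  ultimately show ?thesis
    using that C_def by blast
qed


section \<open>Finitely generated subalgebras\<close>

lemma subalgebra_subspace: "subalgebra B \<Longrightarrow> subspace B"
  by (simp add: subalgebra_def)

lemma subalgebra_mult: "subalgebra B \<Longrightarrow> x \<in> B \<Longrightarrow> y \<in> B \<Longrightarrow> x * y \<in> B"
  by (simp add: subalgebra_def)

lemma subalgebra_generated_subalgebra: "subalgebra (generated_subalgebra S)"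
  unfolding generated_subalgebra_def
  by (rule hull_in) (auto simp: subalgebra_def intro: subspace_Inter)

lemma generated_subalgebra_superset: "S \<subseteq> generated_subalgebra S"
  unfolding generated_subalgebra_def by (rule hull_subset)

lemma generated_subalgebra_minimal:
  "S \<subseteq> B \<Longrightarrow> subalgebra B \<Longrightarrow> generated_subalgebra S \<subseteq> B"
  unfolding generated_subalgebra_def by (rule hull_minimal)

lemma span_subset_generated_subalgebra: "span S \<subseteq> generated_subalgebra S"
  by (simp add: generated_subalgebra_superset span_minimal subalgebra_subspace
      subalgebra_generated_subalgebra)

lemma linear_mult_left: "Vector_Spaces.linear scale scale (\<lambda>y. x * y)"
  by (simp add: linear_iff vector_space_axioms distrib_left scale_mult_right)

lemma generated_subalgebra_subset_powers:
  "generated_subalgebra {a} \<subseteq> span {a ^ m | m. m \<ge> 1}"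
proof (rule generated_subalgebra_minimal)
  let ?P = "{a ^ m | m. m \<ge> 1}"
  show "{a} \<subseteq> span ?P"
    using span_base[of "a ^ 1" ?P] by fastforce
  have power_mult: "a ^ m * y \<in> span ?P" if "m \<ge> 1" "y \<in> span ?P" for m y
    using that(2)
  proof (induction rule: span_induct_alt)
    case base
    then show ?case by (simp add: span_zero)
  next
    case (step c x y)
    then obtain k where "x = a ^ k" "k \<ge> 1" by blast
    then have "a ^ m * x = a ^ (m + k)" "m + k \<ge> 1" using that(1) by (auto simp: power_add)
    then have "a ^ m * x \<in> span ?P" by (metis (mono_tags, lifting) mem_Collect_eq span_base)
    then show ?case
      using step.IH by (simp add: distrib_left scale_mult_right span_add span_scale)
  qed
  have "x * y \<in> span ?P" if "x \<in> span ?P" "y \<in> span ?P" for x y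
    using that(1)
  proof (induction rule: span_induct_alt)
    case base
    then show ?case by (simp add: span_zero)
  next
    case (step c u v)
    then have "u * y \<in> span ?P" using power_mult that(2) by blast
    then show ?case
      using step.IH by (simp add: distrib_right scale_mult_left span_add span_scale)
  qed
  then show "subalgebra (span ?P)"
    by (simp add: subalgebra_def)
qed

lemma algebra_endo_funpow_mult:
  assumes "algebra_endo \<phi>"
  shows "(\<phi> ^^ n) (x * y) = (\<phi> ^^ n) x * (\<phi> ^^ n) y"
  using assms by (induction n) (simp_all add: algebra_endo_def)

lemma endo_image_generated_subalgebra:
  assumes "algebra_endo \<phi>" "\<phi> ` S \<subseteq> generated_subalgebra S"
  shows "\<phi> ` generated_subalgebra S \<subseteq> generated_subalgebra S"
proof -
  let ?G = "generated_subalgebra S"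
  interpret \<phi>: linear scale scale \<phi>
    using assms(1) by (simp add: algebra_endo_def)
  have "subalgebra (\<phi> -` ?G)"
    unfolding subalgebra_def
  proof
    show "subspace (\<phi> -` ?G)"
      using \<phi>.subspace_vimage subalgebra_generated_subalgebra subalgebra_subspace by blast
    show "\<forall>x\<in>\<phi> -` ?G. \<forall>y\<in>\<phi> -` ?G. x * y \<in> \<phi> -` ?G"
      using assms(1) subalgebra_mult[OF subalgebra_generated_subalgebra]
      by (simp add: algebra_endo_def)
  qed
  then show ?thesis
    using generated_subalgebra_minimal[of S "\<phi> -` ?G"] assms(2) by blast
qed

text \<open>
  The preimage of the generated subalgebra under a derivation need not be closed under
  multiplication, but its intersection with the generated subalgebra is.
\<close>
lemma derivation_image_generated_subalgebra:
  assumes "derivation D" "D ` S \<subseteq> generated_subalgebra S"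
  shows "D ` generated_subalgebra S \<subseteq> generated_subalgebra S"
proof -
  let ?G = "generated_subalgebra S"
  let ?H = "?G \<inter> D -` ?G"
  interpret D: linear scale scale D
    using assms(1) by (simp add: derivation_def)
  have G: "subspace ?G"
    using subalgebra_generated_subalgebra subalgebra_subspace by blast
  have "subalgebra ?H"
    unfolding subalgebra_def
  proof
    show "subspace ?H"
      using G by (intro subspace_inter D.subspace_vimage)
    show "\<forall>x\<in>?H. \<forall>y\<in>?H. x * y \<in> ?H"
      using assms(1) subalgebra_mult[OF subalgebra_generated_subalgebra]
        subspace_add[OF G] by (simp add: derivation_def)
  qed
  then show ?thesis
    using generated_subalgebra_minimal[of S ?H] generated_subalgebra_superset[of S] assms(2)
    by blast
qed

lemma locally_finite_orbit_basis:
  assumes "locally_finite \<eta>"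
  obtains S where "finite S" "x \<in> span S" "\<eta> ` span S \<subseteq> span S"
proof -
  let ?O = "range (\<lambda>i. (\<eta> ^^ i) x)"
  interpret \<eta>: linear scale scale \<eta>
    using assms by (simp add: locally_finite_def)
  obtain S where S: "finite S" "span S = span ?O"
    using assms unfolding locally_finite_def fin_dim_def by metis
  have "(\<eta> ^^ 0) x \<in> span ?O"
    by (intro span_base) blast
  moreover have "\<eta> ` ?O \<subseteq> ?O"
    by (auto intro: range_eqI[of _ _ "Suc i" for i])
  then have "\<eta> ` span ?O \<subseteq> span ?O"
    using \<eta>.span_image[of ?O] span_mono by metis
  ultimately show ?thesis
    using that S by simp
qed

section \<open>Algebraic elements and idempotents\<close>

text \<open>
  By Fitting's lemma, left multiplication by \<open>a\<close> is bijective on \<open>C = a\<^sup>n G\<close>, where \<open>G\<close> is the algebra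
  generated by \<open>a\<close>. Since \<open>a\<^sup>n\<^sup>+\<^sup>1\<close> lies in \<open>C\<close>, it can be divided by itself within \<open>C\<close>, and the
  quotient is an idempotent because division is unique.
\<close>
lemma exists_idempotent_absorbing_power:
  assumes "fin_dim (generated_subalgebra {a})"
  obtains e k where "e \<in> generated_subalgebra {a}" "e * e = e" "a ^ k * e = a ^ k"
proof -
  let ?G = "generated_subalgebra {a}" and ?L = "\<lambda>y. a * y"
  note mult = subalgebra_mult[OF subalgebra_generated_subalgebra]
  have a: "a \<in> ?G"
    using generated_subalgebra_superset by blast
  have pow: "(?L ^^ i) y = a ^ i * y" for i y
    by (induction i) (simp_all add: mult.assoc)
  have "?L ` ?G \<subseteq> ?G"
    using a mult by blast
  then obtain n where inj: "inj_on ?L ((?L ^^ n) ` ?G)"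
    and surj: "?L ` ((?L ^^ n) ` ?G) = (?L ^^ n) ` ?G"
    using fitting_bijective_power[OF linear_mult_left assms] by blast
  define C where "C = (?L ^^ n) ` ?G"
  have "a * (a ^ i * y) \<in> ?G" if "y \<in> ?G" for i y
    using that a mult by (induction i) (auto simp: mult.assoc)
  then have C_sub: "C \<subseteq> ?G"
    using mult a by (cases n) (auto simp: C_def pow mult.assoc)
  have C_mult: "x * y \<in> C" if x: "x \<in> C" and y: "y \<in> C" for x y
  proof -
    obtain u where u: "u \<in> ?G" "x = a ^ n * u"
      using x by (auto simp: C_def pow)
    then have "x * y = (?L ^^ n) (u * y)" "u * y \<in> ?G"
      using y C_sub mult by (auto simp: pow mult.assoc)
    then show ?thesis
      unfolding C_def by blast
  qed
  have bij: "bij_betw ?L C C"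
    using inj surj by (simp add: bij_betw_def C_def)
  have bij_pow: "bij_betw (\<lambda>y. a ^ i * y) C C" for i
  proof (induction i)
    case 0
    then show ?case by (simp add: bij_betw_def inj_on_def)
  next
    case (Suc i)
    have "bij_betw (?L \<circ> (\<lambda>y. a ^ i * y)) C C"
      by (rule bij_betw_trans[OF Suc bij])
    then show ?case
      by (simp add: o_def mult.assoc)
  qed
  have "a ^ Suc n \<in> C"
    using a by (auto simp: C_def pow power_commutes[symmetric] simp del: power.simps
        simp: power_Suc2)
  then obtain e where e: "e \<in> C" "a ^ Suc n * e = a ^ Suc n"
    using bij_pow[of "Suc n"] unfolding bij_betw_def by (metis imageE)
  have "a ^ Suc n * (e * e) = a ^ Suc n * e"
    using e(2) by (metis mult.assoc)
  then have "e * e = e"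
    using bij_pow[of "Suc n"] e(1) C_mult by (auto simp: bij_betw_def dest: inj_onD)
  then show ?thesis
    using that e C_sub by blast
qed

lemma mathieu_subspace_if_idempotents_absorbed:
  assumes V: "subspace V"
    and alg: "\<And>a. fin_dim (generated_subalgebra {a})"
    and idem: "\<And>e b c. e \<in> V \<Longrightarrow> e * e = e \<Longrightarrow> b * e * c \<in> V"
  shows "mathieu_subspace V"
  unfolding mathieu_subspace_def
proof (intro conjI allI impI)
  show "subspace V" by (rule V)
  fix a b c
  assume a: "\<forall>m\<ge>1. a ^ m \<in> V"
  obtain e k where e: "e \<in> generated_subalgebra {a}" "e * e = e" "a ^ k * e = a ^ k"
    using exists_idempotent_absorbing_power[OF alg] by blast
  have "span {a ^ m | m. m \<ge> 1} \<subseteq> V"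
    using a V by (intro span_minimal) auto
  then have "e \<in> V"
    using e(1) generated_subalgebra_subset_powers by blast
  have "b * a ^ m * c \<in> V" if "m \<ge> k" for m
  proof -
    have "a ^ m * e = a ^ m"
      using that e(3) by (metis le_add_diff_inverse2 mult.assoc power_add)
    then show ?thesis
      using idem[OF \<open>e \<in> V\<close> e(2), of "b * a ^ m" c] by (simp add: mult.assoc)
  qed
  then show "\<forall>\<^sub>F m in sequentially. b * a ^ m * c \<in> V"
    by (auto simp: eventually_sequentially)
qed

section \<open>Traces on finite-dimensional subspaces\<close>

text \<open>
  The trace is attached to a basis \<open>B\<close> rather than to the subspace \<open>span B\<close>: the trace of a commutator
  vanishes in every basis, in particular in the one adapted to a given projection, where the trace of
  the projection is visibly its rank.
\<close>
definition trace_on :: "'a set \<Rightarrow> ('a \<Rightarrow> 'a) \<Rightarrow> 'k" where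
  "trace_on B f = (\<Sum>b\<in>B. representation B (f b) b)"

lemma trace_on_cong: "(\<And>b. b \<in> B \<Longrightarrow> f b = g b) \<Longrightarrow> trace_on B f = trace_on B g"
  by (simp add: trace_on_def)

lemma trace_on_diff:
  assumes "independent B" "\<And>b. b \<in> B \<Longrightarrow> f b \<in> span B" "\<And>b. b \<in> B \<Longrightarrow> g b \<in> span B"
  shows "trace_on B (\<lambda>b. f b - g b) = trace_on B f - trace_on B g"
  using assms by (simp add: trace_on_def representation_diff sum_subtractf)

text \<open>
  The diagonal sum of a product of two matrices, written as the double sum that is symmetric in the two
  maps; this symmetry is what makes traces of commutators vanish.
\<close>
lemma trace_on_comp:
  assumes B: "finite B" "independent B"
    and f: "Vector_Spaces.linear scale scale f" "f ` span B \<subseteq> span B"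
    and g: "g ` span B \<subseteq> span B"
  shows "trace_on B (\<lambda>b. f (g b))
    = (\<Sum>b\<in>B. \<Sum>c\<in>B. representation B (g b) c * representation B (f c) b)"
  unfolding trace_on_def
proof (rule sum.cong[OF refl])
  interpret f: linear scale scale f by (rule f(1))
  fix b assume "b \<in> B"
  then have gb: "g b \<in> span B"
    using g span_base by blast
  have fc: "f c \<in> span B" if "c \<in> B" for c
    using that f(2) span_base by blast
  have "g b = (\<Sum>c\<in>B. representation B (g b) c *s c)"
    using sum_representation_eq[OF B(2) gb B(1)] by simp
  then have "f (g b) = (\<Sum>c\<in>B. representation B (g b) c *s f c)"
    by (metis (no_types, lifting) f.scale f.sum sum.cong)
  then show "representation B (f (g b)) b
      = (\<Sum>c\<in>B. representation B (g b) c * representation B (f c) b)"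
    using fc by (simp add: representation_sum[OF B(2)] representation_scale[OF B(2)] span_scale)
qed

lemma trace_on_commute:
  assumes B: "finite B" "independent B"
    and f: "Vector_Spaces.linear scale scale f" "f ` span B \<subseteq> span B"
    and g: "Vector_Spaces.linear scale scale g" "g ` span B \<subseteq> span B"
  shows "trace_on B (\<lambda>b. f (g b)) = trace_on B (\<lambda>b. g (f b))"
proof -
  have "(\<Sum>b\<in>B. \<Sum>c\<in>B. representation B (g b) c * representation B (f c) b)
      = (\<Sum>c\<in>B. \<Sum>b\<in>B. representation B (f c) b * representation B (g b) c)"
    by (subst sum.swap) (simp add: mult.commute)
  then show ?thesis
    by (simp only: trace_on_comp[OF B f g(2)] trace_on_comp[OF B g f(2)])
qed

text \<open>
  In a basis that extends a basis \<open>E\<close> of the image \<open>e C\<close>, the matrix of the projection \<open>y \<mapsto> e y\<close> has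
  diagonal entry \<open>1\<close> at the vectors of \<open>E\<close>, which it fixes, and \<open>0\<close> at the others, which it sends
  into the span of \<open>E\<close>.
\<close>
lemma idempotent_trace_eq_card:
  assumes C: "subalgebra C" "fin_dim C" and e: "e \<in> C" "e * e = e"
  obtains E B where "finite B" "independent B" "span B = C" "E \<subseteq> B"
    "span E = (\<lambda>y. e * y) ` C" "trace_on B (\<lambda>y. e * y) = of_nat (card E)"
proof -
  let ?L = "\<lambda>y. e * y"
  interpret L: linear scale scale ?L
    by (rule linear_mult_left)
  have LC: "?L ` C \<subseteq> C"
    using C(1) e(1) by (auto simp: subalgebra_def)
  have "fin_dim (?L ` C)"
    using C(2) linear_mult_left fin_dim_image by blast
  then obtain E where E: "independent E" "span E = ?L ` C"
    unfolding fin_dim_def by blast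
  then have "E \<subseteq> C"
    using LC span_superset by blast
  with E(1) obtain B where B: "E \<subseteq> B" "B \<subseteq> C" "independent B" "C \<subseteq> span B"
    using maximal_independent_subset_extend by blast
  have span_B: "span B = C"
    using B C(1) by (simp add: span_minimal subalgebra_def subset_antisym)
  obtain B0 where "finite B0" "span B0 = C"
    using C(2) fin_dim_def by blast
  then have fin_B: "finite B"
    using independent_span_bound B(2,3) by blast
  have diag: "representation B (e * b) b = (if b \<in> E then 1 else 0)" if b: "b \<in> B" for b
  proof (cases "b \<in> E")
    case True
    then obtain y where "b = e * y"
      using E(2) span_base by blast
    then have "e * b = b"
      using e(2) by (metis mult.assoc)
    then show ?thesis
      using True b representation_basis[OF B(3)] by simp
  next
    case False
    have "e * b \<in> span E"
      using E(2) B(2) b by blast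
    then have "representation B (e * b) = representation E (e * b)"
      using representation_extend[OF B(3) _ B(1)] by simp
    then show ?thesis
      using False representation_ne_zero by auto
  qed
  have "trace_on B ?L = of_nat (card E)"
    using fin_B B(1) by (simp add: trace_on_def diag sum.If_cases Int_absorb1)
  then show ?thesis
    using that fin_B B span_B E by blast
qed

end

locale unital_algebra_char_0 = unital_algebra scale
  for scale :: "'k::field_char_0 \<Rightarrow> 'a::{ring, monoid_mult} \<Rightarrow> 'a" (infixr "*s" 75)
begin

lemma idempotent_eq_0_if_trace_0:
  assumes C: "subalgebra C" "fin_dim C" and e: "e \<in> C" "e * e = e"
    and tr: "\<And>B. finite B \<Longrightarrow> independent B \<Longrightarrow> span B = C \<Longrightarrow> trace_on B (\<lambda>y. e * y) = 0"
  shows "e = 0"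
proof -
  obtain E B where B: "finite B" "independent B" "span B = C" "E \<subseteq> B"
      "span E = (\<lambda>y. e * y) ` C" "trace_on B (\<lambda>y. e * y) = of_nat (card E)"
    by (rule idempotent_trace_eq_card[OF C e])
  have "card E = 0"
    using tr[OF B(1-3)] B(6) by simp
  moreover have "finite E"
    using B(1,4) by (rule rev_finite_subset)
  ultimately have "span E = {0}"
    by simp
  moreover have "e * e \<in> (\<lambda>y. e * y) ` C"
    using e(1) by (rule imageI)
  ultimately show ?thesis
    by (simp only: B(5) e(2) singleton_iff)
qed

section \<open>Idempotents in the image\<close>

text \<open>
  The Leibniz rule \<open>D (x y) - x (D y) = (D x) y\<close> exhibits left multiplication by \<open>e = D x\<close> as a
  commutator.
\<close>
lemma idempotent_in_range_derivation:
  assumes alg: "\<And>S. finite S \<Longrightarrow> fin_dim (generated_subalgebra S)"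
    and D: "derivation D" "locally_finite D"
    and e: "e \<in> range D" "e * e = e"
  shows "e = 0"
proof -
  have lin_D: "Vector_Spaces.linear scale scale D" and leibniz: "D (x * y) = D x * y + x * D y" for x y
    using D(1) by (auto simp: derivation_def)
  obtain x where x: "e = D x"
    using e(1) by blast
  obtain S where S: "finite S" "x \<in> span S" "D ` span S \<subseteq> span S"
    using locally_finite_orbit_basis[OF D(2)] by blast
  define G where "G = generated_subalgebra S"
  have G: "subalgebra G"
    by (simp add: G_def subalgebra_generated_subalgebra)
  have DG: "D ` G \<subseteq> G"
    using derivation_image_generated_subalgebra[OF D(1), of S] S(3) span_superset[of S]
      span_subset_generated_subalgebra[of S] by (auto simp: G_def)
  have xG: "x \<in> G"
    using S(2) span_subset_generated_subalgebra by (auto simp: G_def)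
  have LG: "(\<lambda>y. x * y) ` G \<subseteq> G"
    using G xG subalgebra_mult by blast
  show ?thesis
  proof (rule idempotent_eq_0_if_trace_0[OF G _ _ e(2)])
    show "fin_dim G"
      using alg S(1) by (simp add: G_def)
    show "e \<in> G"
      using x xG DG by blast
    fix B assume B: "finite B" "independent B" "span B = G"
    have BG: "b \<in> G" if "b \<in> B" for b
      using that B(3) span_base by blast
    have "trace_on B (\<lambda>y. e * y) = trace_on B (\<lambda>y. D (x * y) - x * D y)"
      by (simp add: x leibniz)
    also have "\<dots> = trace_on B (\<lambda>y. D (x * y)) - trace_on B (\<lambda>y. x * D y)"
      using BG DG LG by (intro trace_on_diff B(2)) (auto simp: B(3) image_subset_iff)
    also have "trace_on B (\<lambda>y. D (x * y)) = trace_on B (\<lambda>y. x * D y)"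
      using DG LG B(3) by (intro trace_on_commute[OF B(1,2) lin_D _ linear_mult_left]) auto
    finally show "trace_on B (\<lambda>y. e * y) = 0"
      by simp
  qed
qed

text \<open>
  Let \<open>g\<close> be the inverse of \<open>\<phi>\<close> on \<open>C\<close> and \<open>f y = \<phi> (z y)\<close>. On \<open>C\<close>, left multiplication by \<open>z\<close> is
  \<open>g \<circ> f\<close> and left multiplication by \<open>\<phi> z\<close> is \<open>f \<circ> g\<close>, so the two have the same trace.
\<close>
lemma idempotent_eq_0_if_bijective_endo:
  assumes \<phi>: "algebra_endo \<phi>" and C: "subalgebra C" "fin_dim C"
    and bij: "inj_on \<phi> C" "\<phi> ` C = C"
    and z: "z \<in> C" and e: "(z - \<phi> z) * (z - \<phi> z) = z - \<phi> z"
  shows "z - \<phi> z = 0"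
proof -
  interpret vector_space_pair scale scale ..
  have lin: "Vector_Spaces.linear scale scale \<phi>" and mult: "\<phi> (x * y) = \<phi> x * \<phi> y" for x y
    using \<phi> by (auto simp: algebra_endo_def)
  have sub: "subspace C"
    using C(1) by (rule subalgebra_subspace)
  obtain g where g: "range g \<subseteq> C" "Vector_Spaces.linear scale scale g"
      "\<And>v. v \<in> C \<Longrightarrow> g (\<phi> v) = v"
    using linear_exists_left_inverse_on[OF lin sub bij(1)] by blast
  have \<phi>g: "\<phi> (g v) = v" if "v \<in> C" for v
    using that bij(2) g(3) by (metis imageE)
  have \<phi>C: "\<phi> v \<in> C" if "v \<in> C" for v
    using that bij(2) by blast
  let ?f = "\<lambda>y. \<phi> (z * y)"
  have lin_f: "Vector_Spaces.linear scale scale ?f"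
    using Vector_Spaces.linear_compose[OF linear_mult_left lin] by (simp add: o_def)
  have fC: "?f ` C \<subseteq> C"
    using \<phi>C z C(1) by (auto intro: subalgebra_mult)
  show ?thesis
  proof (rule idempotent_eq_0_if_trace_0[OF C _ e])
    show "z - \<phi> z \<in> C"
      using z \<phi>C sub by (simp add: subspace_diff)
    fix B assume B: "finite B" "independent B" "span B = C"
    have BC: "b \<in> C" if "b \<in> B" for b
      using that B(3) span_base by blast
    have "g (?f y) - ?f (g y) = (z - \<phi> z) * y" if "y \<in> C" for y
    proof -
      have "g (?f y) = z * y"
        using that z C(1) by (intro g(3) subalgebra_mult)
      moreover have "?f (g y) = \<phi> z * y"
        using that by (simp only: mult \<phi>g)
      ultimately show ?thesis
        by (simp only: left_diff_distrib)
    qed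
    then have "trace_on B (\<lambda>y. (z - \<phi> z) * y) = trace_on B (\<lambda>y. g (?f y) - ?f (g y))"
      using BC by (intro trace_on_cong) simp
    also have "\<dots> = trace_on B (\<lambda>y. g (?f y)) - trace_on B (\<lambda>y. ?f (g y))"
      using BC fC g(1) B(3) by (intro trace_on_diff B(2)) (auto simp: image_subset_iff)
    also have "trace_on B (\<lambda>y. g (?f y)) = trace_on B (\<lambda>y. ?f (g y))"
      using fC g(1) B(3) by (intro trace_on_commute[OF B(1,2) g(2) _ lin_f]) auto
    finally show "trace_on B (\<lambda>y. (z - \<phi> z) * y) = 0"
      by simp
  qed
qed

text \<open>
  Unlike for a derivation, \<open>e\<close> itself may be nonzero here (for \<open>\<phi> = 0\<close> the image is the whole
  algebra); only its image in the part of \<open>G\<close> on which \<open>\<phi>\<close> is bijective has to vanish.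
\<close>
lemma idempotent_in_range_E_derivation:
  assumes alg: "\<And>S. finite S \<Longrightarrow> fin_dim (generated_subalgebra S)"
    and \<phi>: "algebra_endo \<phi>" and \<delta>: "locally_finite (\<lambda>a. a - \<phi> a)"
    and e: "e \<in> range (\<lambda>a. a - \<phi> a)" "e * e = e"
  obtains n where "(\<phi> ^^ n) e = 0"
proof -
  have lin: "Vector_Spaces.linear scale scale \<phi>"
    using \<phi> by (simp add: algebra_endo_def)
  obtain x where x: "e = x - \<phi> x"
    using e(1) by blast
  obtain S where S: "finite S" "x \<in> span S" "(\<lambda>a. a - \<phi> a) ` span S \<subseteq> span S"
    using locally_finite_orbit_basis[OF \<delta>] by blast
  define G where "G = generated_subalgebra S"
  have "\<phi> s \<in> span S" if "s \<in> span S" for s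
    using that S(3) span_diff[of s S "s - \<phi> s"] by auto
  then have "\<phi> ` S \<subseteq> generated_subalgebra S"
    using span_superset[of S] span_subset_generated_subalgebra[of S] by blast
  then have \<phi>G: "\<phi> ` G \<subseteq> G"
    unfolding G_def by (rule endo_image_generated_subalgebra[OF \<phi>])
  have finG: "fin_dim G"
    using alg S(1) by (simp add: G_def)
  obtain n where n: "inj_on \<phi> ((\<phi> ^^ n) ` G)" "\<phi> ` ((\<phi> ^^ n) ` G) = (\<phi> ^^ n) ` G"
    using fitting_bijective_power[OF lin finG \<phi>G] by blast
  define C where "C = (\<phi> ^^ n) ` G"
  interpret \<phi>n: linear scale scale "\<phi> ^^ n"
    using lin by (rule linear_funpow)
  note pow_mult = algebra_endo_funpow_mult[OF \<phi>, of n]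
  have G: "subalgebra G"
    by (simp add: G_def subalgebra_generated_subalgebra)
  then have "subalgebra C"
    by (auto simp: C_def subalgebra_def \<phi>n.subspace_image simp flip: pow_mult)
  have "x \<in> G"
    using S(2) span_subset_generated_subalgebra by (auto simp: G_def)
  then have z: "(\<phi> ^^ n) x \<in> C"
    by (simp add: C_def)
  have image_e: "(\<phi> ^^ n) e = (\<phi> ^^ n) x - \<phi> ((\<phi> ^^ n) x)"
    by (simp add: x \<phi>n.diff funpow_swap1)
  have "(\<phi> ^^ n) e * (\<phi> ^^ n) e = (\<phi> ^^ n) e"
    using e(2) by (simp flip: pow_mult)
  then have "(\<phi> ^^ n) e = 0"
    using idempotent_eq_0_if_bijective_endo[OF \<phi> \<open>subalgebra C\<close> _ _ _ z] n
      fin_dim_image[OF linear_funpow[OF lin] finG]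
    by (simp add: C_def image_e)
  then show ?thesis
    by (rule that)
qed

lemma funpow_kernel_subset_range:
  assumes "Vector_Spaces.linear scale scale \<phi>" "(\<phi> ^^ n) y = 0"
  shows "y \<in> range (\<lambda>a. a - \<phi> a)"
proof -
  interpret \<phi>: linear scale scale \<phi> by fact
  let ?s = "\<Sum>i<n. (\<phi> ^^ i) y"
  have "?s - \<phi> ?s = (\<Sum>i<n. (\<phi> ^^ i) y - (\<phi> ^^ Suc i) y)"
    by (simp add: \<phi>.sum sum_subtractf)
  also have "\<dots> = y"
    using assms(2) by (subst sum_lessThan_telescope'[where f = "\<lambda>i. (\<phi> ^^ i) y"]) simp
  finally show ?thesis
    by (metis rangeI)
qed

section \<open>The image as a Mathieu subspace\<close>

theorem mathieu_range_derivation: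
  assumes alg: "\<And>S. finite S \<Longrightarrow> fin_dim (generated_subalgebra S)"
    and D: "derivation D" "locally_finite D"
  shows "mathieu_subspace (range D)"
proof (rule mathieu_subspace_if_idempotents_absorbed)
  interpret D: linear scale scale D
    using D(1) by (simp add: derivation_def)
  show sub: "subspace (range D)"
    by (simp add: D.subspace_image)
  show "fin_dim (generated_subalgebra {a})" for a
    by (simp add: alg)
  show "b * e * c \<in> range D" if "e \<in> range D" "e * e = e" for e b c
    using idempotent_in_range_derivation[OF alg D that] subspace_0[OF sub] by simp
qed

theorem mathieu_range_E_derivation:
  assumes alg: "\<And>S. finite S \<Longrightarrow> fin_dim (generated_subalgebra S)"
    and \<phi>: "algebra_endo \<phi>" and \<delta>: "locally_finite (\<lambda>a. a - \<phi> a)"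
  shows "mathieu_subspace (range (\<lambda>a. a - \<phi> a))"
proof (rule mathieu_subspace_if_idempotents_absorbed)
  let ?\<delta> = "\<lambda>a. a - \<phi> a"
  have lin: "Vector_Spaces.linear scale scale \<phi>"
    using \<phi> by (simp add: algebra_endo_def)
  interpret \<delta>: linear scale scale ?\<delta>
    using \<delta> by (simp add: locally_finite_def)
  show "subspace (range ?\<delta>)"
    by (simp add: \<delta>.subspace_image)
  show "fin_dim (generated_subalgebra {a})" for a
    by (simp add: alg)
  show "b * e * c \<in> range ?\<delta>" if e: "e \<in> range ?\<delta>" "e * e = e" for e b c
  proof -
    obtain n where n: "(\<phi> ^^ n) e = 0"
      using idempotent_in_range_E_derivation[OF alg \<phi> \<delta> e] by blast
    have "(\<phi> ^^ n) (b * e * c) = 0"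
      by (simp add: algebra_endo_funpow_mult[OF \<phi>] n)
    then show ?thesis
      using funpow_kernel_subset_range[OF lin] by blast
  qed
qed

end

theorem proposition2p3:
  fixes scale :: "'k::field_char_0 \<Rightarrow> 'a::{ring, monoid_mult} \<Rightarrow> 'a"
    and \<delta> :: "'a \<Rightarrow> 'a"
  assumes "unital_algebra scale"
    and "\<And>S. finite S \<Longrightarrow>
           unital_algebra.fin_dim scale (unital_algebra.generated_subalgebra scale S)"
    and "(unital_algebra.derivation scale \<delta> \<and> unital_algebra.locally_finite scale \<delta>) \<or>
         (unital_algebra.E_derivation scale \<delta> \<and> unital_algebra.locally_finite scale \<delta> \<and>
          (\<exists>\<phi>. unital_algebra.algebra_endo scale \<phi> \<and> \<delta> = (\<lambda>a. a - \<phi> a) \<and>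
             unital_algebra.induced_map scale \<phi> `
               unital_algebra.quotient_space (unital_algebra.Ker_ge1 scale \<phi>)
             = unital_algebra.quotient_space (unital_algebra.Ker_ge1 scale \<phi>)))"
  shows "unital_algebra.mathieu_subspace scale (range \<delta>)"
proof -
  interpret unital_algebra_char_0 scale
    using assms(1) by (simp add: unital_algebra_char_0_def)
  show ?thesis
    using assms(3) mathieu_range_derivation[OF assms(2)] mathieu_range_E_derivation[OF assms(2)]
    by auto
qed

end
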